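(* Let $d\geqslant 11$ and $\mathbb K\in\{\mathbb Z,\mathbb Q,\mathbb R,\mathbb C\}$. Let $\mathcal E$ be a $\mathbb K$--reduced subset of the set of binary forms of degree $d$ with coefficients in $\mathbb K$ and nonzero discriminant. Assume that for each $F\in \mathcal E$ we have \[ d/2\leqslant \Lambda^+ (F)\leqslant d-4, \qquad a_k =0 \text{ for } \Lambda^+ (F)+1 \leqslant k \leqslant \Lambda^+ (F) +4, \] and that if $d$ is even, then $\mathcal E$ contains no trinomial of the form \[ a_0 X^d + a_{d/2} X^{d/2} Y^{d/2} + a_d Y^d. \] Then $\mathcal E$ is $\mathbb K$--homography--free, i.e. for distinct $F,G\in\mathcal E$ there is no $\gamma\in\mathrm{GL}(2,\mathbb K)$ with $F=G\circ\gamma$.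
   Context: Forms are written $F(X,Y)=a_0X^d+a_1X^{d-1}Y+\cdots+a_dY^d$ with $a_0a_d\neq0$, and $\Lambda^+(F)=\max\{\ell: a_i=0 \text{ for } 0<i<\ell\}$. A set $\mathcal E$ of binary forms of degree $d$ with coefficients in $\mathbb K$ is $\mathbb K$--reduced if (1) every $F\in\mathcal E$ has $a_0a_d\neq0$; (2) for $F,G\in\mathcal E$ and $u,v\in\mathbb K^\times$, $F(uX,vY)=G(X,Y)$ implies $F=G$; (3) there is no pair $(F,G)$ of distinct binomial forms $aX^d+bY^d$ in $\mathcal E$ and no $(u,v)\in(\mathbb C^\times)^2$ with $F(vY,uX)=G(X,Y)$. $(F\circ\gamma)(X,Y)=F(u_1X+u_2Y,u_3X+u_4Y)$ for $\gamma$ with rows $(u_1,u_2),(u_3,u_4)$. *)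

theory Defs
  imports
    "HOL-Computational_Algebra.Polynomial"
    "Subresultants.Resultant_Prelim"
begin

text \<open>
  Polynomials in two variables over the complex numbers are elements of
  \<^typ>\<open>complex poly poly\<close>: the inner variable is \<open>X\<close>, the outer variable is \<open>Y\<close>.
  The ring \<open>K\<close> is a subset of the complex numbers, one of
  \<open>\<int>\<close>, \<open>\<rat>\<close>, \<open>\<real>\<close>, \<open>UNIV\<close>.
\<close>

definition varX :: "complex poly poly" where
  "varX = [:[:0, 1:]:]"

definition varY :: "complex poly poly" where
  "varY = [:0, 1:]"

definition const2 :: "complex \<Rightarrow> complex poly poly" where
  "const2 c = [:[:c:]:]"

definition form_of :: "nat \<Rightarrow> (nat \<Rightarrow> complex) \<Rightarrow> complex poly poly" where
  "form_of d a = (\<Sum>i\<le>d. const2 (a i) * varX ^ (d - i) * varY ^ i)"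

definition binary_form :: "nat \<Rightarrow> complex set \<Rightarrow> complex poly poly \<Rightarrow> bool" where
  "binary_form d K F \<longleftrightarrow> (\<exists>a. (\<forall>i\<le>d. a i \<in> K) \<and> F = form_of d a)"

text \<open>The coefficient \<open>a\<^sub>i\<close> of \<open>X\<^sup>d\<^sup>-\<^sup>i Y\<^sup>i\<close>; it is 0 for \<open>i > d\<close> if \<open>F\<close> is a form of degree \<open>d\<close>.\<close>

definition form_coeff :: "nat \<Rightarrow> complex poly poly \<Rightarrow> nat \<Rightarrow> complex" where
  "form_coeff d F i = poly.coeff (poly.coeff F i) (d - i)"

text \<open>The substitution \<open>F(P, Q)\<close>.\<close>

definition subst2 ::
  "complex poly poly \<Rightarrow> complex poly poly \<Rightarrow> complex poly poly \<Rightarrow> complex poly poly" where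
  "subst2 F P Q = poly (map_poly (\<lambda>p. poly (map_poly const2 p) P) F) Q"

definition comp_mat :: "complex poly poly \<Rightarrow> complex mat \<Rightarrow> complex poly poly" where
  "comp_mat F \<gamma> = subst2 F
     (const2 (\<gamma> $$ (0,0)) * varX + const2 (\<gamma> $$ (0,1)) * varY)
     (const2 (\<gamma> $$ (1,0)) * varX + const2 (\<gamma> $$ (1,1)) * varY)"

text \<open>
  For \<open>a\<^sub>0 \<noteq> 0\<close>, the discriminant of the form \<open>F\<close> of degree \<open>d\<close> is the discriminant
  of \<open>f = F(X, 1)\<close>, a polynomial of degree \<open>d\<close>, hence equal to
  \<open>(-1)\<^bsup>d(d-1)/2\<^esup> Res(f, f') / a\<^sub>0\<close>. The definition is used only
  for forms with \<open>a\<^sub>0 a\<^sub>d \<noteq> 0\<close>.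
\<close>

definition form_disc :: "nat \<Rightarrow> complex poly poly \<Rightarrow> complex" where
  "form_disc d F = (-1) ^ (d * (d - 1) div 2)
     * resultant (poly F 1) (pderiv (poly F 1)) / form_coeff d F 0"

text \<open>The set below is bounded by \<open>d\<close> if \<open>a\<^sub>d \<noteq> 0\<close> and \<open>d > 0\<close>.\<close>

definition Lambda_plus :: "nat \<Rightarrow> complex poly poly \<Rightarrow> nat" where
  "Lambda_plus d F = Max {l. \<forall>i. 0 < i \<and> i < l \<longrightarrow> form_coeff d F i = 0}"

definition units_in :: "complex set \<Rightarrow> complex set" where
  "units_in K = {u \<in> K. \<exists>w\<in>K. u * w = 1}"

definition GL2 :: "complex set \<Rightarrow> complex mat set" where
  "GL2 K = {\<gamma> \<in> carrier_mat 2 2. elements_mat \<gamma> \<subseteq> K \<and> det \<gamma> \<in> units_in K}"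

definition binomial_form :: "nat \<Rightarrow> complex poly poly \<Rightarrow> bool" where
  "binomial_form d F \<longleftrightarrow>
     (\<exists>a b. a \<noteq> 0 \<and> b \<noteq> 0 \<and> F = const2 a * varX ^ d + const2 b * varY ^ d)"

definition middle_trinomial :: "nat \<Rightarrow> complex poly poly \<Rightarrow> bool" where
  "middle_trinomial d F \<longleftrightarrow>
     (\<exists>a b c. a \<noteq> 0 \<and> b \<noteq> 0 \<and> c \<noteq> 0 \<and>
        F = const2 a * varX ^ d + const2 b * varX ^ (d div 2) * varY ^ (d div 2)
            + const2 c * varY ^ d)"

definition reduced :: "nat \<Rightarrow> complex set \<Rightarrow> complex poly poly set \<Rightarrow> bool" where
  "reduced d K E \<longleftrightarrow>
     (\<forall>F\<in>E. binary_form d K F) \<and>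
     (\<forall>F\<in>E. form_coeff d F 0 * form_coeff d F d \<noteq> 0) \<and>
     (\<forall>F\<in>E. \<forall>G\<in>E. \<forall>u\<in>units_in K. \<forall>v\<in>units_in K.
        subst2 F (const2 u * varX) (const2 v * varY) = G \<longrightarrow> F = G) \<and>
     \<not> (\<exists>F\<in>E. \<exists>G\<in>E. F \<noteq> G \<and> binomial_form d F \<and> binomial_form d G \<and>
        (\<exists>u v. u \<noteq> 0 \<and> v \<noteq> 0 \<and>
           subst2 F (const2 v * varY) (const2 u * varX) = G))"

definition homography_free :: "complex set \<Rightarrow> complex poly poly set \<Rightarrow> bool" where
  "homography_free K E \<longleftrightarrow>
     (\<forall>F\<in>E. \<forall>G\<in>E. F \<noteq> G \<longrightarrow> \<not> (\<exists>\<gamma>\<in>GL2 K. F = comp_mat G \<gamma>))"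

end

theory Submission
  imports Defs
begin

text \<open>
  Let \<open>F = G \<circ> \<gamma>\<close> with \<open>F = a\<^sub>0 X\<^sup>d + a\<^sub>l X\<^bsup>d-l\<^esup> Y\<^sup>l + O(Y\<^bsup>l+5\<^esup>)\<close> and \<open>G = b\<^sub>0 X\<^sup>d + O(Y\<^sup>m)\<close>, and put
  \<open>M = u\<^sub>3 X + u\<^sub>4 Y\<close>. If \<open>u\<^sub>3\<close> and \<open>u\<^sub>4\<close> are nonzero, rewrite both sides in the variables \<open>M, Y\<close> and
  compare the coefficients of \<open>M\<^sup>k Y\<^bsup>d-k\<^esup>\<close> for \<open>k = d - l - j\<close>, \<open>1 \<le> j \<le> 4\<close>. Since \<open>k < d - l \<le> m\<close>, only
  the terms with \<open>a\<^sub>0\<close>, \<open>a\<^sub>l\<close> and \<open>b\<^sub>0\<close> contribute, and after division by \<open>C(d, k)\<close> the equations say that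
  \<open>C(l + j, j)\<close> is a constant plus a geometric progression in \<open>j\<close>, which is impossible for \<open>l \<ge> 2\<close>.
  If \<open>u\<^sub>3 = 0\<close>, the coefficient of \<open>X\<^bsup>d-1\<^esup> Y\<close> forces \<open>\<gamma>\<close> to be diagonal, and reducedness applies.
  If \<open>u\<^sub>4 = 0\<close>, the coefficient of index \<open>l + 1\<close> forces \<open>\<gamma>\<close> to be antidiagonal, and then \<open>F\<close> is an
  excluded middle trinomial.
\<close>

section \<open>Evaluation and coefficients of forms\<close>

text \<open>Evaluation turns substitution into composition of functions, so that
  \<open>F = comp_mat G \<gamma>\<close> becomes an identity of numbers.\<close>

definition eval2 :: "complex poly poly \<Rightarrow> complex \<Rightarrow> complex \<Rightarrow> complex" where
  "eval2 F x y = poly (poly F [:y:]) x"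

lemma eval2_simps [simp]:
  "eval2 0 x y = 0"
  "eval2 (F + G) x y = eval2 F x y + eval2 G x y"
  "eval2 (F * G) x y = eval2 F x y * eval2 G x y"
  "eval2 (F ^ n) x y = eval2 F x y ^ n"
  "eval2 (const2 c) x y = c"
  "eval2 varX x y = x"
  "eval2 varY x y = y"
  by (simp_all add: eval2_def const2_def varX_def varY_def poly_power)

lemma eval2_sum: "eval2 (\<Sum>i\<in>A. f i) x y = (\<Sum>i\<in>A. eval2 (f i) x y)"
  by (simp add: eval2_def poly_sum)

lemma eval2_poly_const2: "eval2 (poly (map_poly const2 p) P) x y = poly p (eval2 P x y)"
proof (induction p)
  case 0
  then show ?case by simp
next
  case (pCons c p)
  have "map_poly const2 (pCons c p) = pCons (const2 c) (map_poly const2 p)"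
    using pCons.hyps by (intro map_poly_pCons) auto
  with pCons.IH show ?case by simp
qed

lemma eval2_subst2: "eval2 (subst2 F P Q) x y = eval2 F (eval2 P x y) (eval2 Q x y)"
proof (induction F)
  case 0
  then show ?case by (simp add: subst2_def)
next
  case (pCons p F)
  have "subst2 (pCons p F) P Q = poly (map_poly const2 p) P + Q * subst2 F P Q"
    unfolding subst2_def using pCons.hyps by (subst map_poly_pCons) auto
  with pCons.IH show ?case by (simp add: eval2_poly_const2) (simp add: eval2_def)
qed

lemma eval2_form_of: "eval2 (form_of d a) x y = (\<Sum>i\<le>d. a i * x ^ (d - i) * y ^ i)"
  by (simp add: form_of_def eval2_sum)

lemma form_of_monom: "form_of d a = (\<Sum>i\<le>d. monom (monom (a i) (d - i)) i)"
proof -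
  have "const2 c * varX ^ m * varY ^ i = monom (monom c m) i" for c m i
  proof -
    have "varX ^ m = [:monom 1 m:]"
      unfolding varX_def by (simp add: monom_altdef poly_const_pow)
    moreover have "varY ^ i = monom 1 i"
      unfolding varY_def by (simp add: monom_altdef)
    ultimately show ?thesis
      by (simp add: const2_def smult_monom)
  qed
  then show ?thesis by (simp add: form_of_def)
qed

lemma form_coeff_form_of: "i \<le> d \<Longrightarrow> form_coeff d (form_of d a) i = a i"
  by (simp add: form_coeff_def form_of_monom coeff_sum if_distrib [of "\<lambda>p. poly.coeff p _"]
      cong: if_cong)

text \<open>A nonzero last coefficient bounds the set under \<open>Max\<close> by \<open>d\<close>,
  so the maximum belongs to it. Its successor does not, and the only index that can fail is the
  maximum itself.\<close>

lemma Lambda_plus_props: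
  assumes "form_coeff d F d \<noteq> 0" "d > 0"
  shows "\<And>i. 0 < i \<Longrightarrow> i < Lambda_plus d F \<Longrightarrow> form_coeff d F i = 0"
    and "form_coeff d F (Lambda_plus d F) \<noteq> 0"
proof -
  define S where "S = {l. \<forall>i. 0 < i \<and> i < l \<longrightarrow> form_coeff d F i = 0}"
  have L: "Lambda_plus d F = Max S"
    by (simp add: Lambda_plus_def S_def)
  have "S \<subseteq> {..d}"
    using assms by (force simp: S_def)
  then have fin: "finite S"
    by (rule finite_subset) simp
  have "0 \<in> S" by (simp add: S_def)
  with fin have "Max S \<in> S" by (intro Max_in) auto
  then show zero: "\<And>i. 0 < i \<Longrightarrow> i < Lambda_plus d F \<Longrightarrow> form_coeff d F i = 0"
    by (simp add: L S_def)
  have "Suc (Max S) \<notin> S"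
    using Max_ge [OF fin] by (metis Suc_n_not_le_n)
  with zero show "form_coeff d F (Lambda_plus d F) \<noteq> 0"
    by (auto simp: S_def L less_Suc_eq)
qed

section \<open>Powers of linear polynomials and binomial coefficients\<close>

lemma coeff_linear_power_binomial:
  fixes a b :: "'a::comm_semiring_1"
  assumes "k \<le> n"
  shows "poly.coeff ([:a, b:] ^ n) k = of_nat (n choose k) * a ^ (n - k) * b ^ k"
proof -
  have "[:a, b:] ^ n = (monom b 1 + [:a:]) ^ n"
    by (simp add: monom_altdef)
  also have "\<dots> = (\<Sum>i\<le>n. monom (of_nat (n choose i) * a ^ (n - i) * b ^ i) i)"
    unfolding binomial_ring
    by (intro sum.cong) (simp_all add: monom_power poly_const_pow of_nat_poly smult_monom ac_simps)
  finally show ?thesis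
    using assms by (simp add: coeff_sum)
qed

lemma coeff_linear_power_eq_0:
  fixes a b :: "'a::comm_semiring_1"
  assumes "n < k"
  shows "poly.coeff ([:a, b:] ^ n) k = 0"
proof (rule coeff_eq_0)
  have "degree ([:a, b:] ^ n) \<le> degree [:a, b:] * n"
    by (rule degree_power_le)
  also have "\<dots> \<le> n" by simp
  finally show "degree ([:a, b:] ^ n) < k" using assms by simp
qed

lemma coeff_mult_linear_power_eq_0:
  fixes c :: "'a::comm_semiring_1"
  assumes "k < n"
  shows "poly.coeff (p * [:0, c:] ^ n) k = 0"
proof -
  have "[:0, c:] ^ n = monom (c ^ n) n"
    by (metis monom_0 monom_Suc monom_power One_nat_def mult_1)
  with assms show ?thesis
    by (auto simp: coeff_mult intro!: sum.neutral)
qed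

text \<open>Consecutive differences on the right form a geometric progression, whereas those of
  \<open>C(m + j, j)\<close> have the ratios \<open>(m + 2) / 3\<close> and \<open>(m + 3) / 4\<close>, which agree only for \<open>m = 1\<close>.\<close>

lemma binomial_diff_not_geometric:
  fixes A B \<kappa> x z :: complex
  assumes m: "m \<ge> 2" and \<kappa>: "\<kappa> \<noteq> 0"
    and eq: "\<And>j. j \<in> {1..4} \<Longrightarrow> \<kappa> * of_nat ((m + j) choose j) = A - B * x ^ (4 - j) * z ^ j"
  shows False
proof -
  define c where "c j = (of_nat ((m + j) choose j) :: complex)" for j
  have step: "of_nat (Suc j) * c (Suc j) = (of_nat m + of_nat (Suc j)) * c j" for j
  proof -
    have "Suc j * ((m + Suc j) choose Suc j) = (m + Suc j) * ((m + j) choose j)"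
      using Suc_times_binomial_eq [of "m + j" j] by (simp add: ac_simps)
    then show ?thesis unfolding c_def by (metis of_nat_add of_nat_mult)
  qed
  have c2: "2 * c 2 = (of_nat m + 2) * c 1" using step [of 1] by (simp add: numeral_2_eq_2)
  have c3: "3 * c 3 = (of_nat m + 3) * c 2" using step [of 2] by (simp add: numeral_3_eq_3)
  have c4: "4 * c 4 = (of_nat m + 4) * c 3" using step [of 3] by simp
  define M where "M = (of_nat m :: complex)"
  have e: "\<kappa> * c 1 = A - B * x ^ 3 * z" "\<kappa> * c 2 = A - B * x ^ 2 * z ^ 2"
    "\<kappa> * c 3 = A - B * x * z ^ 3" "\<kappa> * c 4 = A - B * z ^ 4"
    using eq [of 1] eq [of 2] eq [of 3] eq [of 4] by (simp_all add: c_def)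
  \<comment> \<open>The differences on the right are \<open>B * (x - z)\<close> times
    \<open>x ^ 2 * z\<close>, \<open>x * z ^ 2\<close>, \<open>z ^ 3\<close>. The product form
    avoids dividing by \<open>x\<close>, \<open>z\<close> or \<open>x - z\<close>, any of which may
    vanish.\<close>
  have "(\<kappa> * c 4 - \<kappa> * c 3) * (\<kappa> * c 2 - \<kappa> * c 1) = (\<kappa> * c 3 - \<kappa> * c 2)\<^sup>2"
    unfolding e by (simp add: eval_nat_numeral algebra_simps)
  then have "\<kappa>\<^sup>2 * ((c 4 - c 3) * (c 2 - c 1)) = \<kappa>\<^sup>2 * (c 3 - c 2)\<^sup>2"
    by (simp add: power2_eq_square algebra_simps)
  with \<kappa> have d: "(c 4 - c 3) * (c 2 - c 1) = (c 3 - c 2)\<^sup>2" by simp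
  have diffs: "2 * (c 2 - c 1) = M * c 1" "3 * (c 3 - c 2) = M * c 2" "4 * (c 4 - c 3) = M * c 3"
    using c2 c3 c4 by (simp_all add: M_def algebra_simps)
  \<comment> \<open>Here 72 = 9 * 4 * 2 = 8 * 3 * 3 supplies the multiples that \<open>diffs\<close>
    rewrites on either side.\<close>
  have "M\<^sup>2 * (9 * c 3 * c 1) = 9 * (4 * (c 4 - c 3)) * (2 * (c 2 - c 1))"
    unfolding diffs by (simp add: power2_eq_square)
  also have "\<dots> = 72 * ((c 4 - c 3) * (c 2 - c 1))"
    by (simp add: algebra_simps)
  also have "\<dots> = 8 * (3 * (c 3 - c 2)) * (3 * (c 3 - c 2))"
    unfolding d power2_eq_square by (simp add: algebra_simps)
  also have "\<dots> = M\<^sup>2 * (8 * c 2 * c 2)"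
    unfolding diffs by (simp add: power2_eq_square)
  finally have "M\<^sup>2 * (9 * c 3 * c 1) = M\<^sup>2 * (8 * c 2 * c 2)" .
  moreover have "M \<noteq> 0" using m by (simp add: M_def)
  ultimately have "3 * (3 * c 3) * c 1 = 4 * (2 * c 2) * c 2" by simp
  then have "3 * ((M + 3) * c 2) * c 1 = 4 * ((M + 2) * c 1) * c 2"
    unfolding c2 c3 M_def .
  then have "(c 1 * c 2) * (3 * (M + 3)) = (c 1 * c 2) * (4 * (M + 2))"
    by (simp only: ac_simps)
  moreover have "c j \<noteq> 0" for j by (simp add: c_def)
  ultimately have "3 * (M + 3) = 4 * (M + 2)" by simp
  then have "M = 1" by (simp add: algebra_simps)
  with m show False by (simp add: M_def)
qed

section \<open>Coefficient sequences with a gap\<close>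

text \<open>The index \<open>l\<close> stands for \<open>Lambda_plus\<close>; its bounds are freed
  of reals and of truncated subtraction.\<close>

definition gap_coeffs :: "nat \<Rightarrow> nat \<Rightarrow> (nat \<Rightarrow> complex) \<Rightarrow> bool" where
  "gap_coeffs d l a \<longleftrightarrow> d \<le> 2 * l \<and> l + 4 \<le> d \<and> a 0 \<noteq> 0 \<and> a l \<noteq> 0 \<and>
     (\<forall>i. 0 < i \<and> i < l \<longrightarrow> a i = 0) \<and> (\<forall>i. l < i \<and> i \<le> l + 4 \<longrightarrow> a i = 0)"

lemma sum_gap_head:
  fixes f :: "nat \<Rightarrow> complex"
  assumes "gap_coeffs d l a" "\<And>i. i \<le> d \<Longrightarrow> a i = 0 \<Longrightarrow> f i = 0"
    and "\<And>i. i \<le> d \<Longrightarrow> l \<le> i \<Longrightarrow> f i = 0"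
  shows "(\<Sum>i\<le>d. f i) = f 0"
proof -
  have "f i = 0" if "i \<le> d" "i \<noteq> 0" for i
    using assms that by (cases "i < l") (auto simp: gap_coeffs_def)
  then have "(\<Sum>i\<le>d. f i) = (\<Sum>i\<in>{0}. f i)"
    by (intro sum.mono_neutral_right) auto
  then show ?thesis by simp
qed

text \<open>The four zeros after \<open>l\<close> postpone the next possible term to index
  \<open>l + 5\<close>, where \<open>f\<close> is assumed to vanish.\<close>

lemma sum_gap_head2:
  fixes f :: "nat \<Rightarrow> complex"
  assumes gap: "gap_coeffs d l a" and a: "\<And>i. i \<le> d \<Longrightarrow> a i = 0 \<Longrightarrow> f i = 0"
    and f: "\<And>i. i \<le> d \<Longrightarrow> l + 5 \<le> i \<Longrightarrow> f i = 0"
  shows "(\<Sum>i\<le>d. f i) = f 0 + f l"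
proof -
  have l: "l \<noteq> 0" "l \<le> d" using gap by (auto simp: gap_coeffs_def)
  have "f i = 0" if "i \<le> d" "i \<noteq> 0" "i \<noteq> l" for i
  proof (cases "i \<le> l + 4")
    case True
    with gap that have "a i = 0" unfolding gap_coeffs_def by (metis linorder_neqE_nat not_gr_zero)
    with a that show ?thesis by simp
  next
    case False
    with f that show ?thesis by simp
  qed
  then have "(\<Sum>i\<le>d. f i) = (\<Sum>i\<in>{0, l}. f i)"
    using l by (intro sum.mono_neutral_right) auto
  with l show ?thesis by simp
qed

section \<open>Two forms with gaps related by a linear substitution\<close>

context
  fixes d l m :: nat and a b :: "nat \<Rightarrow> complex" and u1 u2 u3 u4 :: complex
  assumes gap_a: "gap_coeffs d l a" and gap_b: "gap_coeffs d m b"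
    and lin: "\<And>x y. (\<Sum>i\<le>d. a i * x ^ (d - i) * y ^ i) =
      (\<Sum>i\<le>d. b i * (u1 * x + u2 * y) ^ (d - i) * (u3 * x + u4 * y) ^ i)"
begin

lemma gap_bounds: "d \<le> 2 * l" "d \<le> 2 * m" "l + 4 \<le> d" "m + 4 \<le> d" "l \<ge> 4" "m \<ge> 4"
  using gap_a gap_b by (auto simp: gap_coeffs_def)

text \<open>At \<open>x = 1\<close> both sides of \<open>lin\<close> are polynomials in
  \<open>y\<close> that agree everywhere, and \<open>a k\<close> is the coefficient of
  \<open>y ^ k\<close>.\<close>

lemma coeff_dehomogenised:
  assumes "k \<le> d"
  shows "a k = (\<Sum>i\<le>d. b i * poly.coeff ([:u1, u2:] ^ (d - i) * [:u3, u4:] ^ i) k)"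
proof -
  have "(\<Sum>i\<le>d. monom (a i) i) = (\<Sum>i\<le>d. smult (b i) ([:u1, u2:] ^ (d - i) * [:u3, u4:] ^ i))"
    (is "?p = ?q")
  proof (rule poly_eq_poly_eq_iff [THEN iffD1], rule ext)
    fix y
    show "poly ?p y = poly ?q y"
      using lin [of 1 y] by (simp add: poly_sum poly_monom poly_power mult.assoc mult.commute [of y])
  qed
  then have "poly.coeff ?p k = poly.coeff ?q k" by simp
  with assms show ?thesis by (simp add: coeff_sum)
qed

text \<open>Both sides are evaluated on the line \<open>(z - u\<^sub>4, u\<^sub>3)\<close>, where \<open>u\<^sub>3 X + u\<^sub>4 Y = u\<^sub>3 z\<close>.\<close>

lemma coeff_along_line:
  assumes "k < m" "d < k + l + 5"
  shows "of_nat (d choose k) * a 0 * (- u4) ^ (d - k) +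
      a l * u3 ^ l * poly.coeff ([:- u4, 1:] ^ (d - l)) k =
    of_nat (d choose k) * b 0 * (u2 * u3 - u1 * u4) ^ (d - k) * u1 ^ k"
proof -
  \<comment> \<open>On this line \<open>u1 * x + u2 * y\<close> equals \<open>D + u1 * z\<close>;
    \<open>D\<close> is minus the determinant.\<close>
  define D where "D = u2 * u3 - u1 * u4"
  have "(\<Sum>i\<le>d. smult (a i * u3 ^ i) ([:- u4, 1:] ^ (d - i))) =
      (\<Sum>i\<le>d. smult (b i) ([:D, u1:] ^ (d - i) * [:0, u3:] ^ i))"
    (is "?p = ?q")
  proof (rule poly_eq_poly_eq_iff [THEN iffD1], rule ext)
    fix z
    show "poly ?p z = poly ?q z"
      using lin [of "z - u4" u3] by (simp add: poly_sum poly_power D_def algebra_simps)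
  qed
  then have "poly.coeff ?p k = poly.coeff ?q k" by simp
  \<comment> \<open>For \<open>i \<ge> l + 5\<close> the degree \<open>d - i\<close> is below
    \<open>k\<close>.\<close>
  moreover have "poly.coeff ?p k = a 0 * poly.coeff ([:- u4, 1:] ^ d) k
      + a l * u3 ^ l * poly.coeff ([:- u4, 1:] ^ (d - l)) k"
    unfolding coeff_sum coeff_smult
    by (subst sum_gap_head2 [OF gap_a])
      (use assms in \<open>auto intro!: coeff_linear_power_eq_0\<close>)
  \<comment> \<open>For \<open>i \<ge> m\<close> the power of \<open>u3 * z\<close> starts beyond
    \<open>k\<close>.\<close>
  moreover have "poly.coeff ?q k = b 0 * poly.coeff ([:D, u1:] ^ d) k"
    unfolding coeff_sum coeff_smult
    by (subst sum_gap_head [OF gap_b])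
      (use assms in \<open>auto intro!: coeff_mult_linear_power_eq_0\<close>)
  moreover have "k \<le> d" using assms gap_bounds by linarith
  ultimately show ?thesis
    by (simp add: coeff_linear_power_binomial D_def ac_simps)
qed

lemma second_row_has_zero: "u3 = 0 \<or> u4 = 0"
proof (rule ccontr)
  assume "\<not> (u3 = 0 \<or> u4 = 0)"
  then have u: "u3 \<noteq> 0" "- u4 \<noteq> 0" by auto
  define N T D where "N = d - l" and "T = - u4" and "D = u2 * u3 - u1 * u4"
  \<comment> \<open>Since \<open>l\<close> and \<open>m\<close> are at least d/2,
    \<open>N \<le> m\<close>, and every \<open>k = N - j\<close> with
    \<open>1 \<le> j \<le> 4\<close> is admissible in \<open>coeff_along_line\<close>.\<close>
  have N: "d = l + N" "4 \<le> N" "N \<le> m"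
    using gap_bounds by (auto simp: N_def)
  define \<kappa> where "\<kappa> = - (a l * u3 ^ l) / (of_nat (d choose l) * T ^ l)"
  have nz: "of_nat (d choose l) \<noteq> (0 :: complex)" "T \<noteq> 0"
    using N u by (auto simp: T_def)
  \<comment> \<open>To match \<open>binomial_diff_not_geometric\<close> with \<open>x = u1\<close>
    and \<open>z = D / T\<close>, the split \<open>k = (N - 4) + (4 - j)\<close> moves all factors
    independent of \<open>j\<close> into \<open>B\<close>; \<open>u1\<close> may be zero.\<close>
  have "\<kappa> * of_nat ((l + j) choose j) =
      a 0 - (b 0 * u1 ^ (N - 4) * (D / T) ^ l) * u1 ^ (4 - j) * (D / T) ^ j" if j: "j \<in> {1..4}" for j
  proof -
    define k where "k = N - j"
    have k: "k < m" "d < k + l + 5" "k \<le> N" "d - k = l + j" "N - k = j" "k = (N - 4) + (4 - j)"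
      using N j by (auto simp: k_def)
    \<comment> \<open>Both sides are the multinomial coefficient d! / (k! l! j!).\<close>
    have ch: "of_nat (d choose k) * of_nat ((l + j) choose j) =
        (of_nat (d choose l) * of_nat (N choose k) :: complex)"
    proof -
      have "(d choose k) * ((l + j) choose j) = (d choose (l + j)) * ((l + j) choose l)"
        using k N binomial_symmetric [of k d] binomial_symmetric [of l "l + j"] by simp
      also have "\<dots> = (d choose l) * ((d - l) choose j)"
        using k N j choose_mult [of l "l + j" d] by (simp add: k_def)
      also have "((d - l) choose j) = N choose k"
        using k N j binomial_symmetric [of k N] by simp
      finally show ?thesis by (metis of_nat_mult)
    qed
    have nk: "of_nat (d choose k) \<noteq> (0 :: complex)" using k N by auto
    have coeff: "poly.coeff ([:T, 1:] ^ N) k = of_nat (N choose k) * T ^ j"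
      using coeff_linear_power_binomial [OF k(3), of T 1]
      by (simp only: k(5) power_one mult_1_right)
    have "of_nat (d choose k) * a 0 * T ^ (l + j) + a l * u3 ^ l * (of_nat (N choose k) * T ^ j) =
        of_nat (d choose k) * b 0 * D ^ (l + j) * u1 ^ k"
      by (rule coeff_along_line [OF k(1,2), folded T_def D_def N_def, unfolded coeff k(4)])
    moreover have "a l * u3 ^ l = - \<kappa> * (of_nat (d choose l) * T ^ l)"
      using nz by (simp add: \<kappa>_def)
    ultimately have "of_nat (d choose k) * a 0 * T ^ (l + j)
        - \<kappa> * T ^ (l + j) * (of_nat (d choose l) * of_nat (N choose k)) =
        of_nat (d choose k) * b 0 * D ^ (l + j) * u1 ^ k"
      by (simp add: power_add algebra_simps)
    then have "of_nat (d choose k) * (T ^ (l + j) * (a 0 - \<kappa> * of_nat ((l + j) choose j))) =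
        of_nat (d choose k) * (b 0 * D ^ (l + j) * u1 ^ k)"
      unfolding ch [symmetric] by (simp add: algebra_simps)
    then have "T ^ (l + j) * (a 0 - \<kappa> * of_nat ((l + j) choose j)) = b 0 * D ^ (l + j) * u1 ^ k"
      using nk by simp
    then have "a 0 - \<kappa> * of_nat ((l + j) choose j) = b 0 * (D / T) ^ (l + j) * u1 ^ k"
      using nz by (simp add: power_divide field_simps)
    also have "\<dots> = (b 0 * u1 ^ (N - 4) * (D / T) ^ l) * u1 ^ (4 - j) * (D / T) ^ j"
      by (subst k(6)) (simp only: power_add ac_simps)
    finally show ?thesis by (simp add: algebra_simps)
  qed
  moreover have "\<kappa> \<noteq> 0"
    using gap_a nz u by (simp add: \<kappa>_def gap_coeffs_def)
  moreover have "l \<ge> 2" using gap_bounds by simp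
  ultimately show False by (intro binomial_diff_not_geometric [of l \<kappa>])
qed

text \<open>The terms with \<open>i \<ge> m\<close> are divisible by \<open>y ^ m\<close> and
  \<open>m \<ge> 4\<close>, so \<open>a 1 = 0\<close> comes from
  \<open>b 0 * (u1 * x + u2 * y) ^ d\<close> alone.\<close>

lemma upper_triangular_imp_diagonal:
  assumes "u3 = 0" "u1 \<noteq> 0"
  shows "u2 = 0"
proof -
  have "a 1 = b 0 * poly.coeff ([:u1, u2:] ^ (d - 0) * [:u3, u4:] ^ 0) 1"
    using gap_bounds
    by (subst coeff_dehomogenised, simp, subst sum_gap_head [OF gap_b])
      (auto simp: assms intro!: coeff_mult_linear_power_eq_0)
  then have "of_nat d * b 0 * u1 ^ (d - 1) * u2 = a 1"
    using gap_bounds by (simp add: coeff_linear_power_binomial)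
  moreover have "a 1 = 0" "b 0 \<noteq> 0" "d \<noteq> 0"
    using gap_a gap_b gap_bounds by (auto simp: gap_coeffs_def)
  ultimately show ?thesis using assms by simp
qed

text \<open>The terms with \<open>i \<ge> m\<close> have degree at most \<open>d - m \<le> l\<close>
  in \<open>y\<close>. The zero at \<open>l + 1\<close> in the gap therefore constrains only the
  power of the first row, where \<open>u1\<close> has the positive exponent
  \<open>d - l - 1\<close>.\<close>

lemma zero_corner_imp_antidiagonal:
  assumes "u4 = 0" "u2 \<noteq> 0"
  shows "u1 = 0"
proof -
  have "a (l + 1) = b 0 * poly.coeff ([:u1, u2:] ^ (d - 0) * [:u3, u4:] ^ 0) (l + 1)"
  proof (subst coeff_dehomogenised)
    show "l + 1 \<le> d" using gap_bounds by simp
    have "poly.coeff ([:u1, u2:] ^ (d - i) * [:u3, u4:] ^ i) (l + 1) = 0" if "m \<le> i" for i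
    proof -
      have "[:u3, u4:] ^ i = [:u3 ^ i:]" using assms by (simp add: poly_const_pow)
      moreover have "d - i < l + 1" using that gap_bounds by simp
      ultimately show ?thesis by (simp add: coeff_linear_power_eq_0)
    qed
    then show "(\<Sum>i\<le>d. b i * poly.coeff ([:u1, u2:] ^ (d - i) * [:u3, u4:] ^ i) (l + 1)) =
        b 0 * poly.coeff ([:u1, u2:] ^ (d - 0) * [:u3, u4:] ^ 0) (l + 1)"
      by (intro sum_gap_head [OF gap_b]) auto
  qed
  moreover have "a (l + 1) = 0" "b 0 \<noteq> 0"
    using gap_a gap_b by (auto simp: gap_coeffs_def)
  ultimately have "poly.coeff ([:u1, u2:] ^ d) (l + 1) = 0"
    by simp
  moreover have "l + 1 \<le> d" using gap_bounds by simp
  ultimately show ?thesis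
    using assms by (simp add: coeff_linear_power_binomial del: binomial_Suc_Suc)
qed

lemma antidiagonal_coeff:
  assumes "u1 = 0" "u4 = 0" "k \<le> d"
  shows "a k = b (d - k) * u2 ^ k * u3 ^ (d - k)"
proof -
  have "poly.coeff ([:u1, u2:] ^ (d - i) * [:u3, u4:] ^ i) k =
      (if i = d - k then u2 ^ k * u3 ^ (d - k) else 0)" if "i \<le> d" for i
  proof -
    have "[:u3, u4:] ^ i = [:u3 ^ i:]" using assms by (simp add: poly_const_pow)
    moreover have "[:0, u2:] ^ (d - i) = monom (u2 ^ (d - i)) (d - i)"
      by (metis monom_0 monom_Suc monom_power One_nat_def mult_1)
    ultimately show ?thesis using assms that by auto
  qed
  then show ?thesis
    using assms
    by (subst coeff_dehomogenised) (simp_all add: if_distrib [of "(*) _"] mult.assoc cong: if_cong)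
qed

text \<open>Reversal carries the nonzero \<open>b m\<close> to index \<open>d - m > 0\<close>, so
  \<open>l \<le> d - m\<close>; as both \<open>l\<close> and \<open>m\<close> are at least d/2, they
  equal d/2. The zeros of \<open>b\<close> below \<open>m\<close> then become zeros of
  \<open>a\<close> above \<open>l\<close>.\<close>

lemma antidiagonal_imp_middle:
  assumes "u1 = 0" "u4 = 0" "u2 \<noteq> 0" "u3 \<noteq> 0"
  shows "d = 2 * l" and "\<And>k. k \<le> d \<Longrightarrow> k \<notin> {0, l, d} \<Longrightarrow> a k = 0"
proof -
  have "a (d - m) \<noteq> 0"
    using antidiagonal_coeff [of "d - m"] assms gap_b gap_bounds by (auto simp: gap_coeffs_def)
  then have "l \<le> d - m"
    using gap_a gap_bounds by (auto simp: gap_coeffs_def not_less [symmetric])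
  with gap_bounds show *: "d = 2 * l" by linarith
  then have m: "m = l" using gap_bounds \<open>l \<le> d - m\<close> by linarith
  fix k assume k: "k \<le> d" "k \<notin> {0, l, d}"
  show "a k = 0"
  proof (cases "k < l")
    case True
    with k gap_a show ?thesis by (auto simp: gap_coeffs_def)
  next
    case False
    with k * m have "0 < d - k" "d - k < m" by auto
    with gap_b have "b (d - k) = 0" by (auto simp: gap_coeffs_def)
    with antidiagonal_coeff [of k] assms k show ?thesis by simp
  qed
qed

end

section \<open>Middle trinomials, units and determinants\<close>

lemma middle_trinomial_form_of:
  assumes "d = 2 * l" "l > 0" "a 0 \<noteq> 0" "a l \<noteq> 0" "a d \<noteq> 0"
    and "\<And>k. k \<le> d \<Longrightarrow> k \<notin> {0, l, d} \<Longrightarrow> a k = 0"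
  shows "middle_trinomial d (form_of d a)"
proof -
  have "form_of d a = (\<Sum>i\<in>{0, l, d}. const2 (a i) * varX ^ (d - i) * varY ^ i)"
    unfolding form_of_def using assms
    by (intro sum.mono_neutral_right) (auto simp: const2_def)
  also have "\<dots> = const2 (a 0) * varX ^ d + const2 (a l) * varX ^ (d div 2) * varY ^ (d div 2)
      + const2 (a d) * varY ^ d"
    using assms by simp
  finally show ?thesis using assms unfolding middle_trinomial_def by blast
qed

text \<open>If \<open>u * v * w = 1\<close>, then \<open>v * w\<close> inverts \<open>u\<close> and
  \<open>u * w\<close> inverts \<open>v\<close>; both lie in \<open>K\<close> by closure under
  products.\<close>

lemma mult_in_units_imp_units:
  assumes K: "K \<in> {\<int>, \<rat>, \<real>, UNIV}" and "u \<in> K" "v \<in> K" "u * v \<in> units_in K"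
  shows "u \<in> units_in K" "v \<in> units_in K"
proof -
  have closed: "x * y \<in> K" if "x \<in> K" "y \<in> K" for x y
    using K that by (auto intro: Ints_mult Rats_mult Reals_mult)
  obtain w where "w \<in> K" "u * v * w = 1"
    using assms by (auto simp: units_in_def)
  then have "u * (v * w) = 1" "v * (u * w) = 1"
    by (simp_all add: ac_simps)
  with closed \<open>w \<in> K\<close> assms show "u \<in> units_in K" "v \<in> units_in K"
    unfolding units_in_def by blast+
qed

lemma GL2_entry_in: "\<gamma> \<in> GL2 K \<Longrightarrow> i < 2 \<Longrightarrow> j < 2 \<Longrightarrow> \<gamma> $$ (i, j) \<in> K"
  unfolding GL2_def by (blast intro: elements_matI)

lemma det_2x2:
  fixes A :: "'a::comm_ring_1 mat"
  assumes A: "A \<in> carrier_mat 2 2"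
  shows "det A = A $$ (0,0) * A $$ (1,1) - A $$ (0,1) * A $$ (1,0)"
proof -
  \<comment> \<open>The minor is the entry in row 1 and the other column, which is
    \<open>1 - j\<close>.\<close>
  have "det (mat_delete A 0 j) = A $$ (1, 1 - j)" if "j < 2" for j
  proof -
    have "mat_delete A 0 j \<in> carrier_mat 1 1"
      using mat_delete_carrier [OF A, of 0 j] by simp
    then have "det (mat_delete A 0 j) = mat_delete A 0 j $$ (0, 0)"
      by (rule det_single)
    also have "\<dots> = A $$ (1, 1 - j)"
      using A that by (auto simp: mat_delete_def less_2_cases_iff)
    finally show ?thesis .
  qed
  then show ?thesis
    by (subst laplace_expansion_row [OF A, of 0]) (simp_all add: cofactor_def numeral_2_eq_2)
qed

lemma GL2_det:
  assumes "\<gamma> \<in> GL2 K"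
  shows "\<gamma> $$ (0,0) * \<gamma> $$ (1,1) - \<gamma> $$ (0,1) * \<gamma> $$ (1,0) \<in> units_in K"
proof -
  have "\<gamma> \<in> carrier_mat 2 2" and "det \<gamma> \<in> units_in K"
    using assms unfolding GL2_def by blast+
  then show ?thesis by (simp only: det_2x2)
qed

section \<open>Passage from forms to coefficient sequences\<close>

theorem theorem3p4:
  fixes d :: nat and K :: "complex set" and E :: "complex poly poly set"
  assumes "d \<ge> 11"
    and "K \<in> {\<int>, \<rat>, \<real>, UNIV}"
    and "reduced d K E"
    and "\<forall>F\<in>E. form_disc d F \<noteq> 0"
    and "\<forall>F\<in>E. real d / 2 \<le> real (Lambda_plus d F) \<and> Lambda_plus d F \<le> d - 4"
    and "\<forall>F\<in>E. \<forall>k. Lambda_plus d F + 1 \<le> k \<and> k \<le> Lambda_plus d F + 4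
           \<longrightarrow> form_coeff d F k = 0"
    and "even d \<longrightarrow> \<not> (\<exists>F\<in>E. middle_trinomial d F)"
  shows "homography_free K E"
proof -
  note red = assms(3) [unfolded reduced_def, THEN conjunct1]
    assms(3) [unfolded reduced_def, THEN conjunct2, THEN conjunct1]
    assms(3) [unfolded reduced_def, THEN conjunct2, THEN conjunct2, THEN conjunct1]
  have gap: "\<exists>a. F = form_of d a \<and> a d \<noteq> 0 \<and> gap_coeffs d (Lambda_plus d F) a" if "F \<in> E" for F
  proof -
    let ?l = "Lambda_plus d F"
    have "binary_form d K F" using red(1) that by (rule bspec)
    then obtain a where a: "F = form_of d a"
      unfolding binary_form_def by (elim exE conjE)
    have "real d / 2 \<le> real ?l \<and> ?l \<le> d - 4" using assms(5) that by (rule bspec)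
    then have l: "d \<le> 2 * ?l" "?l + 4 \<le> d"
      using assms(1) by linarith+
    have nz: "form_coeff d F 0 \<noteq> 0" "form_coeff d F d \<noteq> 0"
      using bspec [OF red(2) that] by simp_all
    \<comment> \<open>All indices used below stay in this range because
      \<open>?l + 4 \<le> d\<close>.\<close>
    have coeff: "form_coeff d F i = a i" if "i \<le> d" for i
      using that by (simp add: a form_coeff_form_of)
    have "a i = 0" if "0 < i" "i < ?l" for i
      using Lambda_plus_props(1) [OF nz(2), of i] that coeff [of i] l assms(1) by simp
    moreover have "a ?l \<noteq> 0"
      using Lambda_plus_props(2) [OF nz(2)] coeff [of ?l] l assms(1) by simp
    moreover have "a i = 0" if "?l < i" "i \<le> ?l + 4" for i
      using assms(6) \<open>F \<in> E\<close> that coeff [of i] l by simp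
    ultimately have "gap_coeffs d ?l a"
      using l nz coeff [of 0] by (simp add: gap_coeffs_def)
    with a nz coeff [of d] show ?thesis by auto
  qed
  have "F = G" if FG: "F \<in> E" "G \<in> E" and \<gamma>: "\<gamma> \<in> GL2 K" and FG_eq: "F = comp_mat G \<gamma>" for F G \<gamma>
  proof -
    define l m where "l = Lambda_plus d F" and "m = Lambda_plus d G"
    obtain a where a: "F = form_of d a" "a d \<noteq> 0" "gap_coeffs d l a"
      using gap [OF FG(1)] by (auto simp: l_def)
    obtain b where b: "G = form_of d b" "gap_coeffs d m b"
      using gap [OF FG(2)] by (auto simp: m_def)
    define u1 u2 u3 u4
      where u_def: "u1 = \<gamma> $$ (0,0)" "u2 = \<gamma> $$ (0,1)" "u3 = \<gamma> $$ (1,0)" "u4 = \<gamma> $$ (1,1)"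
    have lin: "(\<Sum>i\<le>d. a i * x ^ (d - i) * y ^ i) =
        (\<Sum>i\<le>d. b i * (u1 * x + u2 * y) ^ (d - i) * (u3 * x + u4 * y) ^ i)" for x y
      using arg_cong [OF FG_eq, of "\<lambda>H. eval2 H x y"]
      by (simp add: comp_mat_def eval2_subst2 a(1) b(1) eval2_form_of u_def)
    note * = a(3) b(2) lin
    have det: "u1 * u4 - u2 * u3 \<in> units_in K"
      using GL2_det [OF \<gamma>] by (simp add: u_def)
    then have det_nz: "u1 * u4 - u2 * u3 \<noteq> 0"
      by (auto simp: units_in_def)
    consider "u3 = 0" | "u4 = 0" "u3 \<noteq> 0"
      using second_row_has_zero [OF *] by blast
    then show ?thesis
    proof cases
      case 1
      with det_nz have "u2 = 0"
        using upper_triangular_imp_diagonal [OF *] by auto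
      with 1 FG_eq have subst: "subst2 G (const2 u1 * varX) (const2 u4 * varY) = F"
        by (simp add: comp_mat_def u_def const2_def)
      \<comment> \<open>With \<open>u3 = 0\<close> the determinant is
        \<open>u1 * u4\<close>.\<close>
      have units: "u1 \<in> units_in K" "u4 \<in> units_in K"
        using mult_in_units_imp_units [OF assms(2), of u1 u4] GL2_entry_in [OF \<gamma>] det 1
        by (auto simp: u_def)
      show ?thesis
        by (rule red(3) [rule_format, OF FG(2,1) units subst, symmetric])
    next
      case 2
      with det_nz have "u2 \<noteq> 0" by auto
      with 2 have "u1 = 0"
        using zero_corner_imp_antidiagonal [OF *] by simp
      note middle = antidiagonal_imp_middle [OF * \<open>u1 = 0\<close> \<open>u4 = 0\<close> \<open>u2 \<noteq> 0\<close> \<open>u3 \<noteq> 0\<close>]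
      have "middle_trinomial d F"
        unfolding a(1) using a(2,3) assms(1) middle
        by (intro middle_trinomial_form_of [of d l]) (auto simp: gap_coeffs_def)
      \<comment> \<open>Since \<open>d = 2 * l\<close> is even, such a trinomial is excluded from
        \<open>E\<close>.\<close>
      with assms(7) FG middle(1) show ?thesis by auto
    qed
  qed
  then show ?thesis by (force simp only: homography_free_def)
qed

end
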